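(* Let $q\ge 7$ be a prime power. In $\mathrm{PG}(2,q)$, let $P_1,P_2$ be two distinct points of the conic $\mathcal{K}$ and let $\mathcal{K}^{**}=\mathcal{K}\setminus\{P_1,P_2\}$. Then the non-zero values $c_i$ for the arc $\mathcal{K}^{**}$ are exactly the following. (i) If $q$ is odd: $c_{(q-1)/2}=\frac{q+1}{2}$, $c_{(q-3)/2}=\frac{(q-1)(q+4)}{2}$, $c_{(q-5)/2}=\frac{(q-1)(q-3)}{2}$, $c_0=2$. (ii) If $q$ is even: $c_{(q-2)/2}=3(q-1)$, $c_{(q-4)/2}=(q-1)(q-2)$, $c_0=3$.
   Context: The conic is $\mathcal{K}=\{(1,t,t^2):t\in\mathbb{F}_q\}\cup\{(0,0,1)\}\subset\mathrm{PG}(2,q)$ (homogeneous coordinates), a set of $q+1$ points no three of which are collinear. A bisecant of an arc (a set of points no three collinear) is a line meeting it in exactly two points. For an arc in $\mathrm{PG}(2,q)$, $c_i$ denotes the number of points of $\mathrm{PG}(2,q)$ not on the arc that lie on exactly $i$ bisecants of the arc. *)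

theory Defs
  imports "HOL-Analysis.Analysis"
begin

text \<open>
  The plane \<open>PG(2,q)\<close> is the lattice of subspaces of \<open>'a^3\<close>, where \<open>'a\<close> is the field
  with \<open>q\<close> elements; incidence of a point with a line is inclusion.
\<close>

definition pg_points :: "('a::field ^ 3) set set" where
  "pg_points = {P. vec.subspace P \<and> vec.dim P = 1}"

definition pg_lines :: "('a::field ^ 3) set set" where
  "pg_lines = {l. vec.subspace l \<and> vec.dim l = 2}"

definition pg_pt :: "'a::field \<Rightarrow> 'a \<Rightarrow> 'a \<Rightarrow> ('a ^ 3) set" where
  "pg_pt x y z = vec.span {vector [x, y, z]}"

definition pg_conic :: "('a::field ^ 3) set set" where
  "pg_conic = range (\<lambda>t. pg_pt 1 t (t^2)) \<union> {pg_pt 0 0 1}"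

definition bisecants :: "('a::field ^ 3) set set \<Rightarrow> ('a ^ 3) set set" where
  "bisecants K = {l \<in> pg_lines. card {P \<in> K. P \<subseteq> l} = 2}"

definition c_num :: "('a::field ^ 3) set set \<Rightarrow> nat \<Rightarrow> nat" where
  "c_num K i = card {P \<in> pg_points - K. card {l \<in> bisecants K. P \<subseteq> l} = i}"

end

theory Submission
  imports Defs
begin

text \<open>
  Only the incidence axioms of a plane of order \<open>q\<close> and the fact that the conic is an oval
  (\<open>q + 1\<close> points, no three collinear) matter. If a point \<open>Q\<close> off the oval lies on \<open>t\<close> tangents
  and \<open>b\<close> bisecants, then \<open>t + 2 b = q + 1\<close>. By parity and counting (Qvist), \<open>t\<close> is \<open>0\<close> or \<open>2\<close>
  for odd \<open>q\<close>; for even \<open>q\<close> it is \<open>1\<close> except at the common point of all tangents. Removing \<open>P\<^sub>1\<close>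
  and \<open>P\<^sub>2\<close> destroys exactly the bisecants among the lines \<open>Q P\<^sub>1\<close> and \<open>Q P\<^sub>2\<close>, which depends
  only on whether \<open>Q\<close> is on the line \<open>P\<^sub>1 P\<^sub>2\<close> and on the tangents at \<open>P\<^sub>1\<close> and \<open>P\<^sub>2\<close>; the
  points of each kind are then counted.
\<close>

section \<open>Ovals in finite projective planes\<close>

text \<open>The axioms demand no quadrangle, so \<open>card_pencil\<close> and
  \<open>card_points\<close> ask for a line \<open>m\<close> missing \<open>p\<close>; on an oval,
  \<open>exists_line_off\<close> supplies it.\<close>

locale finite_projective_plane =
  fixes points :: "'p set" and lines :: "'l set" and inc :: "'p \<Rightarrow> 'l \<Rightarrow> bool"
    and q :: nat
  assumes finite_points: "finite points"
    and finite_lines: "finite lines"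
    and join_exists: "\<lbrakk>a \<in> points; b \<in> points; a \<noteq> b\<rbrakk> \<Longrightarrow> \<exists>l\<in>lines. inc a l \<and> inc b l"
    and meet_exists: "\<lbrakk>l \<in> lines; m \<in> lines; l \<noteq> m\<rbrakk> \<Longrightarrow> \<exists>a\<in>points. inc a l \<and> inc a m"
    and incidence_unique: "\<lbrakk>a \<in> points; b \<in> points; l \<in> lines; m \<in> lines;
      inc a l; inc b l; inc a m; inc b m\<rbrakk> \<Longrightarrow> a = b \<or> l = m"
    and card_line: "l \<in> lines \<Longrightarrow> card {a \<in> points. inc a l} = q + 1"
begin

text \<open>The nested comprehension is the shape in which \<open>sum_multicount\<close> counts
  lines inside the pencil of \<open>a\<close>.\<close>

lemma card_joining_lines:
  assumes "a \<in> points" "b \<in> points" "a \<noteq> b"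
  shows "card {l \<in> {l \<in> lines. inc a l}. inc b l} = 1"
proof -
  obtain l where l: "l \<in> lines" "inc a l" "inc b l" using join_exists assms by blast
  have "{l \<in> {l \<in> lines. inc a l}. inc b l} = {l}"
    using l assms incidence_unique by blast
  then show ?thesis by simp
qed

lemma card_common_points:
  assumes "l \<in> lines" "m \<in> lines" "l \<noteq> m"
  shows "card {a \<in> points. inc a l \<and> inc a m} = 1"
proof -
  obtain a where a: "a \<in> points" "inc a l" "inc a m" using meet_exists assms by blast
  have "{a \<in> points. inc a l \<and> inc a m} = {a}"
    using a assms incidence_unique by blast
  then show ?thesis by simp
qed

text \<open>Lines through \<open>p\<close> correspond to points of \<open>m\<close>; instead of a
  bijection, the incident pairs are counted both ways.\<close>

lemma card_pencil:
  assumes p: "p \<in> points" and m: "m \<in> lines" "\<not> inc p m"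
  shows "card {l \<in> lines. inc p l} = q + 1"
proof -
  have "(\<Sum>x\<in>{a \<in> points. inc a m}. card {l \<in> {l \<in> lines. inc p l}. inc x l}) =
      1 * card {l \<in> lines. inc p l}"
    using card_common_points m
    by (intro sum_multicount) (auto simp: finite_points finite_lines conj_ac Collect_conj_eq[symmetric])
  moreover have "(\<Sum>x\<in>{a \<in> points. inc a m}. card {l \<in> {l \<in> lines. inc p l}. inc x l}) =
      (\<Sum>x\<in>{a \<in> points. inc a m}. 1)"
    using p m by (intro sum.cong refl card_joining_lines) auto
  ultimately show ?thesis using card_line m by simp
qed

text \<open>Each point of \<open>X\<close> is joined to \<open>p\<close> by exactly one line, so the
  pencil of \<open>p\<close> partitions \<open>X\<close>. Applied below to the plane and to the
  oval, each without \<open>p\<close>.\<close>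

lemma sum_joining_lines:
  assumes p: "p \<in> points" and X: "X \<subseteq> points" "p \<notin> X"
  shows "(\<Sum>l\<in>{l \<in> lines. inc p l}. card {x \<in> X. inc x l}) = card X"
proof -
  have fX: "finite X" using X finite_points finite_subset by blast
  have "(\<Sum>x\<in>X. card {l \<in> {l \<in> lines. inc p l}. inc x l}) =
      (\<Sum>l\<in>{l \<in> lines. inc p l}. card {x \<in> X. inc x l})"
    by (intro sum_multicount_gen) (auto simp: fX finite_lines)
  moreover have "(\<Sum>x\<in>X. card {l \<in> {l \<in> lines. inc p l}. inc x l}) = (\<Sum>x\<in>X. 1)"
    using p X by (intro sum.cong refl card_joining_lines) auto
  ultimately show ?thesis by simp
qed

text \<open>Each of the \<open>q + 1\<close> lines through \<open>p\<close> carries \<open>q\<close>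
  further points, and these exhaust the plane.\<close>

lemma card_points:
  assumes p: "p \<in> points" and m: "m \<in> lines" "\<not> inc p m"
  shows "card points = q\<^sup>2 + q + 1"
proof -
  have "card {x \<in> points - {p}. inc x l} = q" if "l \<in> lines" "inc p l" for l
  proof -
    have "{x \<in> points - {p}. inc x l} = {x \<in> points. inc x l} - {p}" by auto
    then show ?thesis using card_line[OF that(1)] that p by (simp add: finite_points)
  qed
  then have "(\<Sum>l\<in>{l \<in> lines. inc p l}. card {x \<in> points - {p}. inc x l}) = (q + 1) * q"
    using card_pencil[OF assms] by simp
  then have "card (points - {p}) = (q + 1) * q"
    using sum_joining_lines[OF p, of "points - {p}"] by simp
  then show ?thesis using p finite_points
    by (metis Suc_eq_plus1 card_Suc_Diff1 add_mult_distrib mult_1 power2_eq_square)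
qed

text \<open>The counterpart of \<open>bisecants\<close> for abstract incidence;
  \<open>sec_num\<close> below yields the index \<open>i\<close> of \<open>c_num\<close>.\<close>

definition secants :: "'p set \<Rightarrow> 'l set" where
  "secants X = {l \<in> lines. card {a \<in> X. inc a l} = 2}"

definition sec_num :: "'p set \<Rightarrow> 'p \<Rightarrow> nat" where
  "sec_num X Q = card {l \<in> secants X. inc Q l}"

end

locale oval = finite_projective_plane points lines inc q
  for points :: "'p set" and lines :: "'l set" and inc and q +
  fixes C :: "'p set"
  assumes order_ge2: "q \<ge> 2"
    and C_subset: "C \<subseteq> points"
    and card_C: "card C = q + 1"
    and arc: "l \<in> lines \<Longrightarrow> card {a \<in> C. inc a l} \<le> 2"
begin

section \<open>Tangents of an oval and tangent counts along a line\<close>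

lemma finite_C: "finite C"
  using C_subset finite_points finite_subset by blast

definition tangents :: "'l set" where
  "tangents = {l \<in> lines. card {a \<in> C. inc a l} = 1}"

definition tan_num :: "'p \<Rightarrow> nat" where
  "tan_num Q = card {l \<in> tangents. inc Q l}"

lemma tangents_subset: "tangents \<subseteq> lines"
  by (auto simp: tangents_def)

lemma finite_tangents: "finite tangents"
  using finite_lines tangents_subset finite_subset by blast

lemma tangent_point_unique:
  assumes "l \<in> tangents" "a \<in> C" "b \<in> C" "inc a l" "inc b l"
  shows "a = b"
proof -
  have "card {a \<in> C. inc a l} = 1" using assms by (simp add: tangents_def)
  then obtain c where "{a \<in> C. inc a l} = {c}" by (rule card_1_singletonE)
  then have "a = c" "b = c" using assms by auto
  then show ?thesis by simp
qed

lemma oval_line_disj: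
  assumes "l \<in> lines" "a \<in> C" "inc a l"
  shows "l \<in> tangents \<or> l \<in> secants C"
proof -
  have "card {a \<in> C. inc a l} \<noteq> 0" using assms finite_C by auto
  then show ?thesis using arc[OF assms(1)] assms(1) by (auto simp: tangents_def secants_def)
qed

lemma three_points_not_collinear:
  assumes "l \<in> lines" "a \<in> C" "b \<in> C" "c \<in> C" "inc a l" "inc b l" "inc c l"
    and "a \<noteq> b" "a \<noteq> c" "b \<noteq> c"
  shows False
proof -
  have "card {a, b, c} \<le> card {a \<in> C. inc a l}"
    using assms finite_C by (intro card_mono) auto
  then show False using arc[OF assms(1)] assms by simp
qed

text \<open>Since \<open>q \<ge> 2\<close>, the oval has two points besides \<open>p\<close>, and
  the line joining them cannot contain a third.\<close>

lemma exists_line_off: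
  assumes p: "p \<in> C"
  obtains m where "m \<in> lines" "\<not> inc p m"
proof -
  have "card (C - {p}) \<ge> 2" using p card_C order_ge2 finite_C by simp
  then obtain D where "D \<subseteq> C - {p}" "card D = 2" using obtain_subset_with_card_n by metis
  then obtain a b where ab: "a \<in> C" "b \<in> C" "a \<noteq> b" "a \<noteq> p" "b \<noteq> p"
    by (auto simp: card_2_iff)
  then obtain m where "m \<in> lines" "inc a m" "inc b m"
    using join_exists C_subset by blast
  then show ?thesis using that three_points_not_collinear ab p by metis
qed

lemma card_pencil_oval:
  assumes "p \<in> C"
  shows "card {l \<in> lines. inc p l} = q + 1"
proof -
  obtain m where "m \<in> lines" "\<not> inc p m" using exists_line_off[OF assms] .
  then show ?thesis using card_pencil assms C_subset by blast
qed

lemma card_all_points: "card points = q\<^sup>2 + q + 1"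
proof -
  have "C \<noteq> {}" using card_C by auto
  then obtain p where p: "p \<in> C" by blast
  obtain m where "m \<in> lines" "\<not> inc p m" using exists_line_off[OF p] .
  then show ?thesis using card_points p C_subset by blast
qed

text \<open>Of the \<open>q + 1\<close> lines through \<open>p\<close>, the other \<open>q\<close>
  points of \<open>C\<close> take up one each as bisecants; a single line remains.\<close>

lemma tan_num_oval:
  assumes p: "p \<in> C"
  shows "tan_num p = 1"
proof -
  let ?L = "{l \<in> lines. inc p l}"
  have eq: "card {x \<in> C - {p}. inc x l} = (if l \<in> tangents then 0 else 1)" if "l \<in> ?L" for l
  proof -
    have "{x \<in> C - {p}. inc x l} = {x \<in> C. inc x l} - {p}" by auto
    then have "card {x \<in> C - {p}. inc x l} = card {x \<in> C. inc x l} - 1"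
      using that p finite_C by simp
    moreover have "l \<in> tangents \<or> l \<in> secants C" using oval_line_disj that p by blast
    ultimately show ?thesis by (auto simp: tangents_def secants_def)
  qed
  have "q = card (C - {p})" using p finite_C card_C by simp
  also have "\<dots> = (\<Sum>l\<in>?L. card {x \<in> C - {p}. inc x l})"
    using p C_subset by (intro sum_joining_lines[symmetric]) auto
  also have "\<dots> = (\<Sum>l\<in>?L. if l \<in> tangents then 0 else 1)"
    using eq by (rule sum.cong[OF refl])
  also have "\<dots> = card (?L - tangents)"
    by (subst sum.If_cases) (auto simp: finite_lines Diff_eq)
  also have "\<dots> = card ?L - card {l \<in> tangents. inc p l}"
  proof -
    have "?L - tangents = ?L - {l \<in> tangents. inc p l}" by auto
    then show ?thesis using tangents_subset finite_tangents by (auto intro!: card_Diff_subset)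
  qed
  finally have "q = q + 1 - tan_num p" using card_pencil_oval[OF p] by (simp add: tan_num_def)
  \<comment> \<open>The left side is positive, so the subtraction on naturals has not been
    truncated.\<close>
  then show ?thesis using order_ge2 by linarith
qed

lemma tangent_unique:
  assumes "p \<in> C" "l \<in> tangents" "m \<in> tangents" "inc p l" "inc p m"
  shows "l = m"
proof -
  have "card {l \<in> tangents. inc p l} = 1" using tan_num_oval assms by (simp add: tan_num_def)
  then obtain n where "{l \<in> tangents. inc p l} = {n}" using card_1_singletonE by blast
  then have "l = n" "m = n" using assms by auto
  then show ?thesis by simp
qed

lemma tangent_exists:
  assumes "p \<in> C"
  obtains l where "l \<in> tangents" "inc p l"
proof -
  have "card {l \<in> tangents. inc p l} = 1" using tan_num_oval assms by (simp add: tan_num_def)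
  then have "{l \<in> tangents. inc p l} \<noteq> {}" by (metis card.empty zero_neq_one)
  then show ?thesis using that by blast
qed

text \<open>Each point of \<open>C\<close> has one tangent and each tangent has one point of
  \<open>C\<close>.\<close>

lemma card_tangents: "card tangents = q + 1"
proof -
  have "(\<Sum>p\<in>C. card {l \<in> tangents. inc p l}) = 1 * card tangents"
    by (intro sum_multicount finite_C finite_tangents) (simp add: tangents_def)
  moreover have "(\<Sum>p\<in>C. card {l \<in> tangents. inc p l}) = (\<Sum>p\<in>C. 1)"
    using tan_num_oval by (intro sum.cong refl) (simp add: tan_num_def)
  ultimately show ?thesis using card_C by simp
qed

text \<open>The lines through \<open>Q\<close> partition \<open>C\<close>, a tangent taking one
  point and a bisecant two. Hence \<open>tan_num Q\<close> has the parity of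
  \<open>q + 1\<close>.\<close>

lemma tan_num_sec_num:
  assumes Q: "Q \<in> points - C"
  shows "tan_num Q + 2 * sec_num C Q = q + 1"
proof -
  let ?L = "{l \<in> lines. inc Q l}"
  have "q + 1 = (\<Sum>l\<in>?L. card {x \<in> C. inc x l})"
    using Q C_subset card_C by (subst sum_joining_lines) auto
  also have "\<dots> = (\<Sum>l\<in>?L. of_bool (l \<in> tangents) + 2 * of_bool (l \<in> secants C))"
  proof (rule sum.cong[OF refl])
    fix l assume "l \<in> ?L"
    then have "l \<in> lines" "card {x \<in> C. inc x l} \<le> 2" using arc by auto
    then show "card {x \<in> C. inc x l} = of_bool (l \<in> tangents) + 2 * of_bool (l \<in> secants C)"
      by (auto simp: tangents_def secants_def)
  qed
  also have "\<dots> = card (?L \<inter> tangents) + 2 * card (?L \<inter> secants C)"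
    using finite_lines by (simp add: sum.distrib sum_distrib_left[symmetric] Int_def)
  also have "?L \<inter> tangents = {l \<in> tangents. inc Q l}" by (auto simp: tangents_def)
  also have "?L \<inter> secants C = {l \<in> secants C. inc Q l}" by (auto simp: secants_def)
  finally show ?thesis by (simp add: tan_num_def sec_num_def)
qed

text \<open>Double counting of points of \<open>l\<close> against tangents through them: a tangent
  other than \<open>l\<close> meets \<open>l\<close> once, while \<open>l\<close>, if tangent,
  counts at all its \<open>q + 1\<close> points. The oval points of \<open>l\<close> contribute one
  each and form the second summand.\<close>

lemma sum_tan_num_line:
  assumes l: "l \<in> lines"
  shows "(\<Sum>Q\<in>{Q \<in> points - C. inc Q l}. tan_num Q) + card {p \<in> C. inc p l} =
    (if l \<in> tangents then 2 * q + 1 else q + 1)"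
proof -
  let ?X = "{Q \<in> points. inc Q l}"
  have fX: "finite ?X" by (simp add: finite_points)
  have "(\<Sum>Q\<in>?X. tan_num Q) = (\<Sum>m\<in>tangents. card {Q \<in> ?X. inc Q m})"
    unfolding tan_num_def
    by (intro sum_multicount_gen) (auto simp: finite_points finite_tangents)
  also have "\<dots> = (\<Sum>m\<in>tangents. if m = l then q + 1 else 1)"
  proof (rule sum.cong[OF refl])
    fix m assume m: "m \<in> tangents"
    show "card {Q \<in> ?X. inc Q m} = (if m = l then q + 1 else 1)"
      using card_line[OF l] card_common_points[OF l, of m] m tangents_subset
      by (auto simp: conj_ac)
  qed
  \<comment> \<open>The excess of \<open>l\<close> over the other tangents is split off so that
    \<open>sum.delta\<close> applies.\<close>
  also have "\<dots> = (\<Sum>m\<in>tangents. (if m = l then q else 0) + 1)"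
    by (rule sum.cong) auto
  also have "\<dots> = (if l \<in> tangents then 2 * q + 1 else q + 1)"
    unfolding sum.distrib using card_tangents finite_tangents by (simp add: sum.delta)
  finally have "(\<Sum>Q\<in>?X. tan_num Q) = (if l \<in> tangents then 2 * q + 1 else q + 1)" .
  moreover have "(\<Sum>Q\<in>?X. tan_num Q) =
      (\<Sum>Q\<in>{Q \<in> points - C. inc Q l}. tan_num Q) + (\<Sum>Q\<in>{p \<in> C. inc p l}. tan_num Q)"
  proof -
    have "?X = {Q \<in> points - C. inc Q l} \<union> {p \<in> C. inc p l}" using C_subset by auto
    then show ?thesis
      using finite_points finite_C by (simp only:) (intro sum.union_disjoint, auto)
  qed
  moreover have "(\<Sum>Q\<in>{p \<in> C. inc p l}. tan_num Q) = card {p \<in> C. inc p l}"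
    using tan_num_oval by simp
  ultimately show ?thesis by simp
qed

lemma card_line_off_oval:
  assumes "l \<in> lines"
  shows "card {Q \<in> points - C. inc Q l} + card {p \<in> C. inc p l} = q + 1"
proof -
  have "card ({Q \<in> points - C. inc Q l} \<union> {p \<in> C. inc p l}) =
      card {Q \<in> points - C. inc Q l} + card {p \<in> C. inc p l}"
    by (rule card_Un_disjoint) (auto simp: finite_points finite_C)
  moreover have "{Q \<in> points - C. inc Q l} \<union> {p \<in> C. inc p l} = {Q \<in> points. inc Q l}"
    using C_subset by auto
  ultimately show ?thesis using card_line[OF assms] by simp
qed

lemma card_tangent_off_oval: "l \<in> tangents \<Longrightarrow> card {Q \<in> points - C. inc Q l} = q"
  using card_line_off_oval[of l] by (simp add: tangents_def)

lemma card_secant_off_oval: "l \<in> secants C \<Longrightarrow> card {Q \<in> points - C. inc Q l} = q - 1"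
  using card_line_off_oval[of l] by (simp add: secants_def)

section \<open>Points off the oval by their number of tangents\<close>

lemma tan_num_pos_iff: "tan_num Q > 0 \<longleftrightarrow> (\<exists>l\<in>tangents. inc Q l)"
  using finite_tangents by (auto simp: tan_num_def card_gt_0_iff)

text \<open>Parity forces every point on a tangent (off the oval) to lie on a second one, and the
  other \<open>q\<close> tangents only suffice for one extra at each of these \<open>q\<close> points.\<close>

lemma tan_num_odd:
  assumes "odd q" and Q: "Q \<in> points - C"
  shows "tan_num Q = 0 \<or> tan_num Q = 2"
proof (rule disjCI)
  assume "tan_num Q \<noteq> 2"
  show "tan_num Q = 0"
  proof (rule ccontr)
    assume "tan_num Q \<noteq> 0"
    then obtain l where l: "l \<in> tangents" "inc Q l" using tan_num_pos_iff by blast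
    let ?X = "{Q \<in> points - C. inc Q l}"
    have ge: "tan_num R \<ge> 2" if "R \<in> ?X" for R
    proof -
      have "tan_num R > 0" using that l tan_num_pos_iff by blast
      moreover have "even (tan_num R)"
        using tan_num_sec_num[of R] that \<open>odd q\<close>
        by (metis (no_types, lifting) even_add even_mult_iff even_numeral mem_Collect_eq odd_one)
      ultimately show ?thesis by (auto elim!: evenE)
    qed
    have "(\<Sum>R\<in>?X. tan_num R) = 2 * q"
      using sum_tan_num_line[of l] l by (simp add: tangents_def)
    also have "\<dots> = (\<Sum>R\<in>?X. 2)" using card_tangent_off_oval l by simp
    finally have "(\<Sum>R\<in>?X. tan_num R) = (\<Sum>R\<in>?X. 2)" .
    moreover have "2 < tan_num Q" using ge[of Q] Q l \<open>tan_num Q \<noteq> 2\<close> by simp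
    then have "(\<Sum>R\<in>?X. 2) < (\<Sum>R\<in>?X. tan_num R)"
      using Q l ge
      by (intro sum_strict_mono_ex1) (auto simp: finite_points)
    ultimately show False by simp
  qed
qed

text \<open>The tangent numbers of the \<open>q - 1\<close> points of \<open>l\<close> off the oval
  are odd, hence at least 1, and they add up to only \<open>q - 1\<close>.\<close>

lemma tan_num_even_secant:
  assumes "even q" and Q: "Q \<in> points - C" and l: "l \<in> secants C" "inc Q l"
  shows "tan_num Q = 1"
proof (rule ccontr)
  assume "tan_num Q \<noteq> 1"
  let ?X = "{Q \<in> points - C. inc Q l}"
  have ge: "tan_num R \<ge> 1" if "R \<in> ?X" for R
  proof -
    have "odd (tan_num R)"
      using tan_num_sec_num[of R] that \<open>even q\<close>
      by (metis (no_types, lifting) even_add even_mult_iff even_numeral mem_Collect_eq odd_one)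
    then show ?thesis by (simp add: odd_pos Suc_leI)
  qed
  have "l \<in> lines" "l \<notin> tangents" using l by (auto simp: secants_def tangents_def)
  then have "(\<Sum>R\<in>?X. tan_num R) = q - 1"
    using sum_tan_num_line[of l] l by (simp add: secants_def)
  also have "\<dots> = (\<Sum>R\<in>?X. 1)" using card_secant_off_oval l by simp
  finally have "(\<Sum>R\<in>?X. tan_num R) = (\<Sum>R\<in>?X. 1)" .
  moreover have "1 < tan_num Q" using ge[of Q] Q l \<open>tan_num Q \<noteq> 1\<close> by simp
  then have "(\<Sum>R\<in>?X. 1) < (\<Sum>R\<in>?X. tan_num R)"
    using Q l ge
    by (intro sum_strict_mono_ex1) (auto simp: finite_points)
  ultimately show False by simp
qed

text \<open>A point on no bisecant has only tangents through it, by \<open>tan_num_sec_num\<close>;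
  this second value belongs to the nucleus.\<close>

lemma tan_num_even:
  assumes "even q" and Q: "Q \<in> points - C"
  shows "tan_num Q = 1 \<or> tan_num Q = q + 1"
proof (cases "sec_num C Q = 0")
  case True
  then show ?thesis using tan_num_sec_num[OF Q] by simp
next
  case False
  then have "{l \<in> secants C. inc Q l} \<noteq> {}" by (metis card.empty sec_num_def)
  then show ?thesis using tan_num_even_secant[OF assms] by blast
qed

text \<open>Each of the \<open>q + 1\<close> tangents has \<open>q\<close> points off the oval, and
  each external point lies on two tangents.\<close>

lemma card_external_odd:
  assumes "odd q"
  shows "2 * card {Q \<in> points - C. tan_num Q = 2} = (q + 1) * q"
proof -
  have "(\<Sum>Q\<in>points - C. tan_num Q) = (\<Sum>l\<in>tangents. card {Q \<in> points - C. inc Q l})"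
    unfolding tan_num_def
    by (intro sum_multicount_gen) (auto simp: finite_points finite_tangents)
  also have "\<dots> = (q + 1) * q" using card_tangent_off_oval card_tangents by simp
  also have "(\<Sum>Q\<in>points - C. tan_num Q) = (\<Sum>Q\<in>points - C. if tan_num Q = 2 then 2 else 0)"
    using tan_num_odd[OF assms] by (intro sum.cong) auto
  also have "\<dots> = 2 * card {Q \<in> points - C. tan_num Q = 2}"
    using finite_points by (subst sum.inter_filter[symmetric]) auto
  finally show ?thesis .
qed

text \<open>The tangents at the \<open>q - 1\<close> oval points off \<open>l\<close> meet
  \<open>l\<close> outside the oval, two of them at each external point.\<close>

lemma card_external_secant_odd:
  assumes "odd q" and l: "l \<in> secants C"
  shows "2 * card {Q \<in> points - C. inc Q l \<and> tan_num Q = 2} = q - 1"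
proof -
  have "l \<in> lines" "l \<notin> tangents" using l by (auto simp: secants_def tangents_def)
  then have "q - 1 = (\<Sum>R\<in>{Q \<in> points - C. inc Q l}. tan_num R)"
    using sum_tan_num_line[of l] l by (simp add: secants_def)
  also have "\<dots> = (\<Sum>Q\<in>{Q \<in> points - C. inc Q l}. if tan_num Q = 2 then 2 else 0)"
    using tan_num_odd[OF assms(1)] by (intro sum.cong) auto
  also have "\<dots> = 2 * card {Q \<in> {Q \<in> points - C. inc Q l}. tan_num Q = 2}"
    using finite_points by (subst sum.inter_filter[symmetric]) auto
  also have "{Q \<in> {Q \<in> points - C. inc Q l}. tan_num Q = 2} =
      {Q \<in> points - C. inc Q l \<and> tan_num Q = 2}" by auto
  finally show ?thesis by simp
qed

end

section \<open>Ovals with two points removed\<close>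

text \<open>The tangents \<open>t1\<close>, \<open>t2\<close> and the chord \<open>m\<close> are
  parameters because they alone decide how many bisecants through a point are lost.\<close>

locale oval_minus_two = oval points lines inc q C
  for points :: "'p set" and lines :: "'l set" and inc and q and C +
  fixes P1 P2 :: 'p and t1 t2 m :: 'l
  assumes P1: "P1 \<in> C" and P2: "P2 \<in> C" and P1_P2: "P1 \<noteq> P2"
    and t1: "t1 \<in> tangents" "inc P1 t1"
    and t2: "t2 \<in> tangents" "inc P2 t2"
    and m: "m \<in> lines" "inc P1 m" "inc P2 m"
begin

abbreviation "K \<equiv> C - {P1, P2}"

text \<open>The abstract form of \<open>c_num\<close>; as there, the deleted points are among those
  counted.\<close>

definition point_count :: "nat \<Rightarrow> nat" where
  "point_count i = card {Q \<in> points - K. sec_num K Q = i}"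

section \<open>Bisecants lost with the two deleted points\<close>

lemma m_secant: "m \<in> secants C"
  using oval_line_disj[OF m(1) P1 m(2)] tangent_point_unique[OF _ P1 P2 m(2,3)] P1_P2 by blast

lemma P1_not_t2: "\<not> inc P1 t2" and P2_not_t1: "\<not> inc P2 t1"
  using tangent_point_unique P1 P2 P1_P2 t1 t2 by blast+

lemma t1_t2: "t1 \<noteq> t2"
  using P1_not_t2 t1 by blast

text \<open>The lines \<open>m\<close> and \<open>t1\<close> already share \<open>P1\<close>. This
  makes the point classes counted later disjoint.\<close>

lemma not_m_t1:
  assumes "Q \<in> points - C" "inc Q t1"
  shows "\<not> inc Q m"
proof
  assume "inc Q m"
  then have "t1 = m"
    using incidence_unique[of Q P1 t1 m] assms t1 m P1 C_subset tangents_subset by blast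
  then show False using P2_not_t1 m by blast
qed

lemma not_m_t2:
  assumes "Q \<in> points - C" "inc Q t2"
  shows "\<not> inc Q m"
proof
  assume "inc Q m"
  then have "t2 = m"
    using incidence_unique[of Q P2 t2 m] assms t2 m P2 C_subset tangents_subset by blast
  then show False using P1_not_t2 m by blast
qed

text \<open>A line with two points in \<open>K\<close> has no further point of \<open>C\<close>, so
  no bisecant is created, and those through \<open>P1\<close> or \<open>P2\<close> are
  destroyed.\<close>

lemma secants_K: "secants K = {l \<in> secants C. \<not> inc P1 l \<and> \<not> inc P2 l}"
proof (intro equalityI subsetI)
  fix l assume "l \<in> secants K"
  then have l: "l \<in> lines" "card {a \<in> K. inc a l} = 2" by (auto simp: secants_def)
  have fin: "finite {a \<in> C. inc a l}" using finite_C by simp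
  have "{a \<in> K. inc a l} = {a \<in> C. inc a l}"
    using arc[OF l(1)] l(2) by (intro card_seteq fin) auto
  then have "\<not> inc P1 l" "\<not> inc P2 l" using P1 P2 by auto
  then show "l \<in> {l \<in> secants C. \<not> inc P1 l \<and> \<not> inc P2 l}"
    using l \<open>{a \<in> K. inc a l} = {a \<in> C. inc a l}\<close> by (simp add: secants_def)
next
  fix l assume l: "l \<in> {l \<in> secants C. \<not> inc P1 l \<and> \<not> inc P2 l}"
  then have "{a \<in> K. inc a l} = {a \<in> C. inc a l}" by auto
  then show "l \<in> secants K" using l by (simp add: secants_def)
qed

text \<open>Only the line joining \<open>Q\<close> and \<open>P\<close> qualifies, and it is a
  bisecant unless it is the tangent at \<open>P\<close>.\<close>

lemma card_secants_through:
  assumes Q: "Q \<in> points - C" and P: "P \<in> C" and t: "t \<in> tangents" "inc P t"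
  shows "card {l \<in> secants C. inc Q l \<and> inc P l} = of_bool (\<not> inc Q t)"
proof -
  have ne: "Q \<noteq> P" "Q \<in> points" "P \<in> points" using Q P C_subset by auto
  then obtain n where n: "n \<in> lines" "inc Q n" "inc P n" using join_exists by blast
  have uniq: "l = n" if "l \<in> lines" "inc Q l" "inc P l" for l
    using incidence_unique[of Q P l n] that n ne by blast
  have disj: "secants C \<inter> tangents = {}" by (auto simp: secants_def tangents_def)
  have sl: "secants C \<subseteq> lines" by (auto simp: secants_def)
  show ?thesis
  proof (cases "inc Q t")
    case True
    then have "t = n" using uniq t tangents_subset by blast
    then have "{l \<in> secants C. inc Q l \<and> inc P l} = {}" using uniq t disj sl by blast
    then show ?thesis using True by (simp only: card.empty) simp
  next
    case False
    then have "n \<notin> tangents" using tangent_unique[OF P t(1) _ t(2) n(3)] n by blast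
    then have "n \<in> secants C" using oval_line_disj n P by blast
    then have "{l \<in> secants C. inc Q l \<and> inc P l} = {n}" using uniq n sl by blast
    then show ?thesis using False by simp
  qed
qed

text \<open>Inclusion-exclusion over the bisecants through \<open>P1\<close> and through
  \<open>P2\<close>, which share only \<open>m\<close>. The additive form avoids subtraction on
  naturals.\<close>

lemma sec_num_K:
  assumes Q: "Q \<in> points - C"
  shows "sec_num K Q + of_bool (\<not> inc Q t1) + of_bool (\<not> inc Q t2) =
    sec_num C Q + of_bool (inc Q m)"
proof -
  let ?S = "\<lambda>P. {l \<in> secants C. inc Q l \<and> inc P l}"
  have fin: "finite (secants C)" using finite_lines by (simp add: secants_def)
  have m_unique: "l = m" if "l \<in> secants C" "inc P1 l" "inc P2 l" for l
  proof -
    have "l \<in> lines" using that(1) by (simp add: secants_def)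
    then show ?thesis
      using incidence_unique[OF _ _ _ m(1) that(2,3) m(2,3)] P1 P2 P1_P2 C_subset by blast
  qed
  have "?S P1 \<inter> ?S P2 = (if inc Q m then {m} else {})"
  proof (rule set_eqI)
    fix l
    show "l \<in> ?S P1 \<inter> ?S P2 \<longleftrightarrow> l \<in> (if inc Q m then {m} else {})"
      using m_unique[of l] m_secant m(2,3) by (cases "l = m") auto
  qed
  then have int: "card (?S P1 \<inter> ?S P2) = of_bool (inc Q m)" by simp
  have "card (?S P1) + card (?S P2) = card (?S P1 \<union> ?S P2) + card (?S P1 \<inter> ?S P2)"
    using fin finite_points by (intro card_Un_Int) auto
  moreover have "sec_num C Q = sec_num K Q + card (?S P1 \<union> ?S P2)"
  proof -
    have "{l \<in> secants C. inc Q l} = {l \<in> secants K. inc Q l} \<union> (?S P1 \<union> ?S P2)"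
      unfolding secants_K by blast
    moreover have "{l \<in> secants K. inc Q l} \<inter> (?S P1 \<union> ?S P2) = {}"
      unfolding secants_K by blast
    moreover have "finite {l \<in> secants K. inc Q l}" "finite (?S P1 \<union> ?S P2)"
      using fin finite_points by (auto simp: secants_K)
    ultimately show ?thesis unfolding sec_num_def by (simp add: card_Un_disjoint)
  qed
  ultimately show ?thesis
    using int card_secants_through[OF Q P1 t1] card_secants_through[OF Q P2 t2] by simp
qed

lemma sec_num_K_removed: "sec_num K P1 = 0" "sec_num K P2 = 0"
proof -
  have "{l \<in> secants K. inc P1 l} = {}" "{l \<in> secants K. inc P2 l} = {}"
    unfolding secants_K by auto
  then show "sec_num K P1 = 0" "sec_num K P2 = 0" by (simp_all only: sec_num_def card.empty)
qed

section \<open>Sizes of the classes of points off the reduced arc\<close>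

lemma points_minus_K: "points - K = (points - C) \<union> {P1, P2}"
  using P1 P2 C_subset by auto

lemma card_points_minus_C: "card (points - C) = q\<^sup>2"
  using card_all_points card_C C_subset finite_C by (simp add: card_Diff_subset)

lemma point_count_pos:
  assumes "i \<noteq> 0"
  shows "point_count i = card {Q \<in> points - C. sec_num K Q = i}"
proof -
  have "{Q \<in> points - K. sec_num K Q = i} = {Q \<in> points - C. sec_num K Q = i}"
    unfolding points_minus_K using sec_num_K_removed assms by auto
  then show ?thesis by (simp add: point_count_def)
qed

text \<open>The summand 2 stands for \<open>P1\<close> and \<open>P2\<close>, which are off
  \<open>K\<close> and on none of its bisecants.\<close>

lemma point_count_0: "point_count 0 = card {Q \<in> points - C. sec_num K Q = 0} + 2"
proof -
  have "{Q \<in> points - K. sec_num K Q = 0} = {Q \<in> points - C. sec_num K Q = 0} \<union> {P1, P2}"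
    unfolding points_minus_K using sec_num_K_removed by auto
  moreover have "card ({Q \<in> points - C. sec_num K Q = 0} \<union> {P1, P2}) =
      card {Q \<in> points - C. sec_num K Q = 0} + card {P1, P2}"
    using finite_points P1 P2 by (intro card_Un_disjoint) auto
  ultimately show ?thesis using P1_P2 by (simp add: point_count_def)
qed

text \<open>The meeting point is off the oval because a point of \<open>C\<close> has only one
  tangent. For even \<open>q\<close> it turns out to be the nucleus.\<close>

lemma tangents_meet:
  "\<exists>R\<in>points - C. \<forall>Q\<in>points. inc Q t1 \<and> inc Q t2 \<longleftrightarrow> Q = R"
proof -
  obtain R where R: "R \<in> points" "inc R t1" "inc R t2"
    using meet_exists t1 t2 t1_t2 tangents_subset by blast
  have "R \<notin> C" using tangent_unique R t1 t2 t1_t2 by blast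
  moreover have "inc Q t1 \<and> inc Q t2 \<longleftrightarrow> Q = R" if "Q \<in> points" for Q
    using incidence_unique[of Q R t1 t2] that R t1 t2 t1_t2 tangents_subset by blast
  ultimately show ?thesis using R by blast
qed

lemma card_on_t1_or_t2: "card {Q \<in> points - C. inc Q t1 \<or> inc Q t2} = 2 * q - 1"
proof -
  obtain R where R: "R \<in> points - C" "\<forall>Q\<in>points. inc Q t1 \<and> inc Q t2 \<longleftrightarrow> Q = R"
    using tangents_meet by blast
  let ?A = "\<lambda>t. {Q \<in> points - C. inc Q t}"
  have "?A t1 \<inter> ?A t2 = {R}" using R by auto
  moreover have "card (?A t1) + card (?A t2) = card (?A t1 \<union> ?A t2) + card (?A t1 \<inter> ?A t2)"
    using finite_points by (intro card_Un_Int) auto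
  moreover have "?A t1 \<union> ?A t2 = {Q \<in> points - C. inc Q t1 \<or> inc Q t2}" by auto
  ultimately show ?thesis using card_tangent_off_oval t1 t2 by simp
qed

lemma point_count_odd:
  assumes "odd q" "q \<ge> 7"
  shows "{i. point_count i \<noteq> 0} = {(q - 1) div 2, (q - 3) div 2, (q - 5) div 2, 0} \<and>
    point_count ((q - 1) div 2) = (q + 1) div 2 \<and>
    point_count ((q - 3) div 2) = ((q - 1) * (q + 4)) div 2 \<and>
    point_count ((q - 5) div 2) = ((q - 1) * (q - 3)) div 2 \<and>
    point_count 0 = 2"
proof -
  \<comment> \<open>The aim is \<open>q = 2 * j + 7\<close>: the three indices become
    \<open>j + 3\<close>, \<open>j + 2\<close>, \<open>j + 1\<close>, free of subtraction and
    distinct from 0.\<close>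
  obtain k where k: "q = 2 * k + 1" using \<open>odd q\<close> by (elim oddE)
  then have "k \<ge> 3" using \<open>q \<ge> 7\<close> by simp
  then obtain j where j: "k = j + 3" using le_Suc_ex by (metis add.commute)
  have q: "q = 2 * j + 7" using k j by simp
  obtain R where R: "R \<in> points - C" "\<forall>Q\<in>points. inc Q t1 \<and> inc Q t2 \<longleftrightarrow> Q = R"
    using tangents_meet by blast
  have fin: "finite (points - C)" using finite_points by simp
  have ext: "tan_num Q = 2" if "Q \<in> points - C" "inc Q t1 \<or> inc Q t2" for Q
  proof -
    have "tan_num Q > 0" using that(2) tan_num_pos_iff t1 t2 by blast
    then show ?thesis using tan_num_odd[OF \<open>odd q\<close> that(1)] by simp
  qed
  have sC: "sec_num C Q = (if tan_num Q = 2 then j + 3 else j + 4)" if "Q \<in> points - C" for Q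
    using tan_num_sec_num[OF that] tan_num_odd[OF \<open>odd q\<close> that] q by auto
  let ?E = "{Q \<in> points - C. tan_num Q = 2}"
  let ?Em = "{Q \<in> points - C. inc Q m \<and> tan_num Q = 2}"
  let ?T = "{Q \<in> points - C. inc Q t1 \<or> inc Q t2}"
  let ?I = "{Q \<in> points - C. inc Q m \<and> tan_num Q \<noteq> 2}"
  let ?F = "\<lambda>i. {Q \<in> points - C. sec_num K Q = i}"
  \<comment> \<open>External points start with \<open>j + 3\<close> bisecants, internal ones with
    \<open>j + 4\<close>. The point \<open>R\<close> loses none; points of \<open>m\<close>, and
    points on exactly one of \<open>t1\<close>, \<open>t2\<close>, lose one; all others lose
    two.\<close>
  have val: "sec_num K Q = (if Q \<in> insert R ?I then j + 3 else
      if Q \<in> ?E - (?Em \<union> ?T) then j + 1 else j + 2)" if Q: "Q \<in> points - C" for Q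
    using sec_num_K[OF Q] sC[OF Q] ext[OF Q] not_m_t1[OF Q] not_m_t2[OF Q] R(2)[rule_format, of Q] Q
    by (cases "inc Q t1"; cases "inc Q t2"; cases "inc Q m"; cases "tan_num Q = 2") auto
  have RI: "R \<notin> ?I" "R \<notin> ?E - (?Em \<union> ?T)" using R ext not_m_t1 by auto
  have F3: "?F (j + 3) = insert R ?I" using val R(1) by (auto split: if_splits)
  have F1: "?F (j + 1) = ?E - (?Em \<union> ?T)" using val RI by (auto split: if_splits)
  \<comment> \<open>The middle class mixes several kinds of points, so it is counted as a
    complement.\<close>
  have F2: "?F (j + 2) = (points - C) - (?F (j + 3) \<union> ?F (j + 1))" using val by (auto split: if_splits)
  have F0: "?F i = {}" if "i \<notin> {j + 1, j + 2, j + 3}" for i using val that by (auto split: if_splits)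
  have cEm: "card ?Em = j + 3" using card_external_secant_odd[OF \<open>odd q\<close> m_secant] q by simp
  have cI: "card ?I = j + 3"
  proof -
    have "card (?Em \<union> ?I) = card ?Em + card ?I"
      using fin finite_points by (intro card_Un_disjoint) auto
    moreover have "?Em \<union> ?I = {Q \<in> points - C. inc Q m}" by auto
    ultimately show ?thesis using card_secant_off_oval[OF m_secant] cEm q by simp
  qed
  have c3: "card (?F (j + 3)) = j + 4"
    unfolding F3 using RI cI finite_points by simp
  have cU: "card (?Em \<union> ?T) = 5 * j + 16"
  proof -
    have "card (?Em \<union> ?T) = card ?Em + card ?T"
      using finite_points not_m_t1 not_m_t2 by (intro card_Un_disjoint) auto
    then show ?thesis using cEm card_on_t1_or_t2 q by simp
  qed
  have "?Em \<union> ?T \<subseteq> ?E" using ext by auto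
  then have "card (?F (j + 1)) = card ?E - card (?Em \<union> ?T)"
    unfolding F1 using fin finite_points by (intro card_Diff_subset finite_subset[OF _ fin]) auto
  moreover have "card ?E = (j + 4) * (2 * j + 7)"
  proof -
    have "2 * card ?E = 2 * ((j + 4) * (2 * j + 7))"
      using card_external_odd[OF \<open>odd q\<close>] q by (simp add: algebra_simps)
    then show ?thesis by linarith
  qed
  ultimately have c1: "card (?F (j + 1)) = (j + 3) * (2 * j + 4)"
    using cU by (simp add: algebra_simps)
  have "card (?F (j + 2)) = card (points - C) - card (?F (j + 3) \<union> ?F (j + 1))"
    by (subst F2, intro card_Diff_subset finite_subset[OF _ fin]) auto
  also have "card (?F (j + 3) \<union> ?F (j + 1)) = card (?F (j + 3)) + card (?F (j + 1))"
    using fin finite_points by (intro card_Un_disjoint) auto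
  finally have c2: "card (?F (j + 2)) = (j + 3) * (2 * j + 11)"
    using c1 c3 card_points_minus_C q by (simp add: algebra_simps power2_eq_square)
  have c0: "card (?F 0) = 0" by (subst F0) simp_all
  have p: "point_count (j + 3) = j + 4" "point_count (j + 2) = (j + 3) * (2 * j + 11)"
      "point_count (j + 1) = (j + 3) * (2 * j + 4)" "point_count 0 = 2"
    using c0 c1 c2 c3 by (simp_all add: point_count_pos point_count_0)
  have p0: "point_count i = 0" if "i \<notin> {j + 1, j + 2, j + 3, 0}" for i
    using that by (subst point_count_pos, simp, subst F0, simp_all)
  have "{i. point_count i \<noteq> 0} = {j + 3, j + 2, j + 1, 0}"
  proof -
    have "point_count i \<noteq> 0 \<longleftrightarrow> i \<in> {j + 3, j + 2, j + 1, 0}" for i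
      using p p0[of i] by (cases "i \<in> {j + 1, j + 2, j + 3, 0}") auto
    then show ?thesis by blast
  qed
  moreover have "(q - 1) div 2 = j + 3" "(q - 3) div 2 = j + 2" "(q - 5) div 2 = j + 1"
      "(q + 1) div 2 = j + 4" using q by auto
  moreover have "(q - 1) * (q + 4) div 2 = (j + 3) * (2 * j + 11)"
  proof -
    have "(q - 1) * (q + 4) = 2 * ((j + 3) * (2 * j + 11))" using q by (simp add: algebra_simps)
    then show ?thesis by simp
  qed
  moreover have "(q - 1) * (q - 3) div 2 = (j + 3) * (2 * j + 4)"
  proof -
    have "(q - 1) * (q - 3) = 2 * ((j + 3) * (2 * j + 4))" using q by (simp add: algebra_simps)
    then show ?thesis by simp
  qed
  ultimately show ?thesis using p by (simp only:)
qed

lemma point_count_even: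
  assumes "even q" "q \<ge> 7"
  shows "{i. point_count i \<noteq> 0} = {(q - 2) div 2, (q - 4) div 2, 0} \<and>
    point_count ((q - 2) div 2) = 3 * (q - 1) \<and>
    point_count ((q - 4) div 2) = (q - 1) * (q - 2) \<and>
    point_count 0 = 3"
proof -
  \<comment> \<open>Evenness raises the bound to 8; with \<open>q = 2 * j + 8\<close> the positive
    indices are \<open>j + 3\<close> and \<open>j + 2\<close>.\<close>
  obtain k where k: "q = 2 * k" using \<open>even q\<close> by (elim evenE)
  then have "k \<ge> 4" using \<open>q \<ge> 7\<close> by simp
  then obtain j where j: "k = j + 4" using le_Suc_ex by (metis add.commute)
  have q: "q = 2 * j + 8" using k j by simp
  obtain N where N: "N \<in> points - C" "\<forall>Q\<in>points. inc Q t1 \<and> inc Q t2 \<longleftrightarrow> Q = N"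
    using tangents_meet by blast
  have fin: "finite (points - C)" using finite_points by simp
  \<comment> \<open>Two tangents through \<open>N\<close> exclude the value 1, so \<open>N\<close>
    is the nucleus.\<close>
  have "{t1, t2} \<subseteq> {l \<in> tangents. inc N l}" using t1 t2 N by auto
  then have "card {t1, t2} \<le> tan_num N"
    unfolding tan_num_def using finite_tangents by (intro card_mono) auto
  then have tN: "tan_num N = q + 1" using tan_num_even[OF \<open>even q\<close> N(1)] t1_t2 by simp
  have tQ: "tan_num Q = 1" if Q: "Q \<in> points - C" "Q \<noteq> N" for Q
  proof (rule ccontr)
    assume "tan_num Q \<noteq> 1"
    then have "card {l \<in> tangents. inc Q l} = card tangents"
      using tan_num_even[OF \<open>even q\<close> Q(1)] card_tangents by (simp add: tan_num_def)
    then have "{l \<in> tangents. inc Q l} = tangents"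
      using finite_tangents by (intro card_subset_eq) auto
    then have "inc Q t1 \<and> inc Q t2" using t1 t2 by blast
    then show False using N(2)[rule_format, of Q] Q by blast
  qed
  have sC: "sec_num C Q = (if Q = N then 0 else j + 4)" if "Q \<in> points - C" for Q
    using tan_num_sec_num[OF that] tQ[OF that] tN q by auto
  let ?M = "{Q \<in> points - C. inc Q m}"
  let ?T = "{Q \<in> points - C. inc Q t1 \<or> inc Q t2}"
  let ?F = "\<lambda>i. {Q \<in> points - C. sec_num K Q = i}"
  \<comment> \<open>Apart from \<open>N\<close>, every point starts with \<open>j + 4\<close>
    bisecants and loses one if it is on \<open>m\<close>, \<open>t1\<close> or \<open>t2\<close>,
    otherwise two.\<close>
  have val: "sec_num K Q = (if Q = N then 0 else if Q \<in> ?M \<union> ?T then j + 3 else j + 2)"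
    if Q: "Q \<in> points - C" for Q
    using sec_num_K[OF Q] sC[OF Q] not_m_t1[OF Q] not_m_t2[OF Q] N(2)[rule_format, of Q] Q
    by (cases "inc Q t1"; cases "inc Q t2"; cases "inc Q m") auto
  have NT: "N \<in> ?T" using N by auto
  have F3: "?F (j + 3) = (?M \<union> ?T) - {N}" using val by (auto split: if_splits)
  have F0: "?F 0 = {N}" using val N(1) by (auto split: if_splits)
  have F2: "?F (j + 2) = (points - C) - (?M \<union> ?T)" using val NT by (auto split: if_splits)
  have Fi: "?F i = {}" if "i \<notin> {j + 2, j + 3, 0}" for i using val that by (auto split: if_splits)
  have cU: "card (?M \<union> ?T) = 3 * q - 2"
  proof -
    have "card (?M \<union> ?T) = card ?M + card ?T"
      using finite_points not_m_t1 not_m_t2 by (intro card_Un_disjoint) auto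
    then show ?thesis using card_secant_off_oval[OF m_secant] card_on_t1_or_t2 q by simp
  qed
  have c3: "card (?F (j + 3)) = 3 * (q - 1)"
    unfolding F3 using cU NT finite_points q by (simp add: card_Diff_singleton)
  have "card (?F (j + 2)) = card (points - C) - card (?M \<union> ?T)"
    unfolding F2 by (intro card_Diff_subset finite_subset[OF _ fin]) auto
  then have c2: "card (?F (j + 2)) = (q - 1) * (q - 2)"
    using cU card_points_minus_C q by (simp add: algebra_simps power2_eq_square)
  have p: "point_count (j + 3) = 3 * (q - 1)" "point_count (j + 2) = (q - 1) * (q - 2)"
      "point_count 0 = 3"
    using c2 c3 F0 by (simp_all add: point_count_pos point_count_0)
  have p0: "point_count i = 0" if "i \<notin> {j + 2, j + 3, 0}" for i
    using that by (subst point_count_pos, simp, subst Fi, simp_all)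
  have "{i. point_count i \<noteq> 0} = {j + 3, j + 2, 0}"
  proof -
    have "point_count i \<noteq> 0 \<longleftrightarrow> i \<in> {j + 3, j + 2, 0}" for i
      using p p0[of i] q by (cases "i \<in> {j + 2, j + 3, 0}") auto
    then show ?thesis by blast
  qed
  moreover have "(q - 2) div 2 = j + 3" "(q - 4) div 2 = j + 2" using q by auto
  ultimately show ?thesis using p by (simp only:)
qed

end

section \<open>The conic in the Desarguesian plane\<close>

lemma pg_point_cases:
  assumes "P \<in> pg_points"
  obtains v :: "'a::field ^ 3" where "v \<noteq> 0" "P = vec.span {v}"
proof -
  have P: "vec.subspace P" "vec.dim P = 1" using assms by (auto simp: pg_points_def)
  obtain B where B: "B \<subseteq> P" "vec.independent B" "P \<subseteq> vec.span B" "card B = 1"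
    using vec.basis_exists[of P] P by metis
  then obtain v where "B = {v}" using card_1_singletonE by blast
  then show ?thesis
    using that[of v] B P vec.span_subspace[of B P] by auto
qed

lemma pg_point_span: "v \<noteq> 0 \<Longrightarrow> vec.span {v} \<in> pg_points"
  by (simp add: pg_points_def)

lemma pg_line_span:
  assumes "v \<noteq> 0" "w \<notin> vec.span {v}"
  shows "vec.span {v, w} \<in> pg_lines"
proof -
  have "vec.dim {w, v} = 2" unfolding vec.dim_insert using assms by simp
  then show ?thesis by (simp add: pg_lines_def insert_commute)
qed

lemma span_singleton_eq_iff:
  assumes "v \<noteq> 0" "w \<noteq> 0"
  shows "vec.span {v} = vec.span {w} \<longleftrightarrow> w \<in> vec.span {v}"
proof
  assume "w \<in> vec.span {v}"
  then have "vec.span {w} \<subseteq> vec.span {v}" by (simp add: vec.span_minimal)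
  then show "vec.span {v} = vec.span {w}"
    using assms vec.subspace_dim_equal[of "vec.span {w}" "vec.span {v}"] by simp
qed (simp add: vec.span_base)

text \<open>The span lies in \<open>l\<close> and has the same dimension 2. Uniqueness of joining
  lines follows from this.\<close>

lemma pg_line_eq_span:
  assumes l: "l \<in> pg_lines" and v: "v \<in> l" "v \<noteq> 0" and w: "w \<in> l" "w \<notin> vec.span {v}"
  shows "l = vec.span {v, w}"
proof -
  have "vec.span {v, w} \<subseteq> l"
    using assms by (intro vec.span_minimal) (auto simp: pg_lines_def)
  then show ?thesis
    using pg_line_span[OF v(2) w(2)] l vec.subspace_dim_equal[of "vec.span {v, w}" l]
    by (simp add: pg_lines_def)
qed

lemma pg_join_exists:
  assumes "P \<in> pg_points" "Q \<in> pg_points" "P \<noteq> Q"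
  shows "\<exists>l\<in>pg_lines. P \<subseteq> l \<and> Q \<subseteq> l"
proof -
  obtain v w where v: "v \<noteq> 0" "P = vec.span {v}" and w: "w \<noteq> 0" "Q = vec.span {w}"
    using pg_point_cases assms by metis
  then have "w \<notin> vec.span {v}" using span_singleton_eq_iff assms by blast
  then have "vec.span {v, w} \<in> pg_lines" using pg_line_span v by blast
  then show ?thesis using v w by (intro bexI[of _ "vec.span {v, w}"]) (simp_all add: vec.span_mono)
qed

lemma pg_incidence_unique:
  assumes "P \<in> pg_points" "Q \<in> pg_points" "l \<in> pg_lines" "m \<in> pg_lines"
    and "P \<subseteq> l" "Q \<subseteq> l" "P \<subseteq> m" "Q \<subseteq> m"
  shows "P = Q \<or> l = m"
proof (rule disjCI)
  assume "l \<noteq> m"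
  obtain v w where v: "v \<noteq> 0" "P = vec.span {v}" and w: "w \<noteq> 0" "Q = vec.span {w}"
    using pg_point_cases assms by metis
  have "v \<in> l" "v \<in> m" "w \<in> l" "w \<in> m"
    using assms v w by (auto intro: vec.span_base)
  then have "w \<in> vec.span {v}" using pg_line_eq_span assms v \<open>l \<noteq> m\<close> by metis
  then show "P = Q" using span_singleton_eq_iff v w by blast
qed

text \<open>By the dimension formula the intersection has dimension at least
  \<open>2 + 2 - 3 = 1\<close>.\<close>

lemma pg_meet_exists:
  fixes l m :: "('a::field ^ 3) set"
  assumes l: "l \<in> pg_lines" and m: "m \<in> pg_lines"
  shows "\<exists>P\<in>pg_points. P \<subseteq> l \<and> P \<subseteq> m"
proof -
  have s: "vec.subspace l" "vec.subspace m" "vec.dim l = 2" "vec.dim m = 2"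
    using l m by (auto simp: pg_lines_def)
  have "vec.dim {x + y |x y. x \<in> l \<and> y \<in> m} + vec.dim (l \<inter> m) = 4"
    using vec.dim_sums_Int[of l m] s by simp
  moreover have "vec.dim {x + y |x y. x \<in> l \<and> y \<in> m} \<le> 3"
    using vec.dim_subset_UNIV[of "{x + y |x y. x \<in> l \<and> y \<in> m}"]
    by (simp add: vec.dimension_def card_cart_basis)
  ultimately have "vec.dim (l \<inter> m) \<noteq> 0" by linarith
  then obtain v where v: "v \<in> l" "v \<in> m" "v \<noteq> 0" by (auto simp: subset_iff)
  then show ?thesis
    using s by (intro bexI[of _ "vec.span {v}"] conjI vec.span_minimal pg_point_span) auto
qed

lemma card_pg_line:
  fixes l :: "('a::{field,finite} ^ 3) set"
  assumes l: "l \<in> pg_lines"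
  shows "card {P \<in> pg_points. P \<subseteq> l} = CARD('a) + 1"
proof -
  have s: "vec.subspace l" "vec.dim l = 2" using l by (auto simp: pg_lines_def)
  obtain B where B: "B \<subseteq> l" "vec.independent B" "l \<subseteq> vec.span B" "card B = 2"
    using vec.basis_exists[of l] s by metis
  then obtain u w where uw: "B = {u, w}" "u \<noteq> w" by (auto simp: card_2_iff)
  have nu: "u \<noteq> 0" "w \<noteq> 0" using B(2) uw vec.dependent_zero by auto
  have nw: "w \<notin> vec.span {u}"
    using B(2) uw vec.independent_insert[of w "{u}"] by (auto simp: insert_commute)
  have lu: "l = vec.span {w, u}" using vec.span_subspace[of B l] B s uw by (auto simp: insert_commute)
  have ul: "u \<in> l" "w \<in> l" using B uw by auto
  \<comment> \<open>The points of \<open>l\<close> are parametrized as an affine line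
    \<open>?f t\<close> together with the point at infinity spanned by \<open>u\<close>.\<close>
  let ?f = "\<lambda>t. vec.span {w + t *s u}"
  have wt: "w + t *s u \<notin> vec.span {u}" for t
  proof
    assume "w + t *s u \<in> vec.span {u}"
    then have "w + t *s u - t *s u \<in> vec.span {u}"
      by (intro vec.span_diff vec.span_scale) (auto intro: vec.span_base)
    then show False using nw by simp
  qed
  then have wn: "w + t *s u \<noteq> 0" for t using vec.span_zero by metis
  have inj: "inj ?f"
  proof (rule injI)
    fix t t' assume "?f t = ?f t'"
    then have "w + t' *s u \<in> vec.span {w + t *s u}" by (simp add: vec.span_base)
    then obtain k where k: "w + t' *s u = k *s (w + t *s u)"
      by (auto simp: vec.span_singleton)
    \<comment> \<open>Comparing coefficients of the independent vectors \<open>w\<close> and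
      \<open>u\<close> will force \<open>k = 1\<close> and then equal parameters.\<close>
    have "(1 - k) *s w = (k * t - t') *s u"
      using k by (simp add: vec_eq_iff algebra_simps)
    moreover have "(k * t - t') *s u \<in> vec.span {u}" by (intro vec.span_scale vec.span_base) simp
    ultimately have 1: "(1 - k) *s w \<in> vec.span {u}" by metis
    have "k = 1"
    proof (rule ccontr)
      assume "k \<noteq> 1"
      then have "w = inverse (1 - k) *s ((1 - k) *s w)" by (subst vec.scale_scale) simp
      moreover have "inverse (1 - k) *s ((1 - k) *s w) \<in> vec.span {u}" using 1 by (rule vec.span_scale)
      ultimately show False using nw by metis
    qed
    then have "t' *s u = t *s u" using k by simp
    then show "t = t'" using nu by simp
  qed
  have "{P \<in> pg_points. P \<subseteq> l} = insert (vec.span {u}) (range ?f)"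
  proof (intro equalityI subsetI)
    fix P assume "P \<in> {P \<in> pg_points. P \<subseteq> l}"
    then obtain v where v: "v \<noteq> 0" "P = vec.span {v}" "P \<subseteq> l" using pg_point_cases by blast
    then have "v \<in> l" by (auto intro: vec.span_base)
    then obtain k where "v - k *s w \<in> vec.span {u}"
      using lu by (auto simp: vec.span_breakdown_eq)
    then obtain t where t: "v - k *s w = t *s u" by (auto simp: vec.span_singleton)
    show "P \<in> insert (vec.span {u}) (range ?f)"
    proof (cases "k = 0")
      case True
      then have "v \<in> vec.span {u}" using t by (simp add: vec.span_scale vec.span_base)
      then show ?thesis using v nu span_singleton_eq_iff by blast
    next
      case False
      \<comment> \<open>Dividing by the coefficient of \<open>w\<close> normalizes the spanning
        vector.\<close>
      have "v = k *s (w + (t / k) *s u)"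
        using t False by (simp add: vec.scale_right_distrib diff_eq_eq add.commute)
      also have "\<dots> \<in> ?f (t / k)" by (intro vec.span_scale vec.span_base) simp
      finally have "v \<in> ?f (t / k)" .
      then have "P = ?f (t / k)" using v wn span_singleton_eq_iff by blast
      then show ?thesis by blast
    qed
  next
    fix P assume "P \<in> insert (vec.span {u}) (range ?f)"
    then consider "P = vec.span {u}" | t where "P = ?f t" by blast
    then show "P \<in> {P \<in> pg_points. P \<subseteq> l}"
    proof cases
      case 1
      then show ?thesis using ul s nu by (simp add: pg_point_span vec.span_minimal)
    next
      case 2
      have "w + t *s u \<in> l" using ul s by (simp add: vec.subspace_add vec.subspace_scale)
      then show ?thesis using 2 s wn by (simp add: pg_point_span vec.span_minimal)
    qed
  qed
  moreover have "vec.span {u} \<notin> range ?f"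
  proof
    assume "vec.span {u} \<in> range ?f"
    then obtain t where "vec.span {u} = ?f t" by blast
    then show False using wt[of t] by (simp add: vec.span_base)
  qed
  ultimately show ?thesis using inj by (simp add: card_image)
qed

section \<open>The conic as an oval\<close>

lemma pg_pt_in_points: "x \<noteq> 0 \<or> y \<noteq> 0 \<or> z \<noteq> 0 \<Longrightarrow> pg_pt x y z \<in> pg_points"
  unfolding pg_pt_def by (intro pg_point_span) (auto simp: vec_eq_iff forall_3)

lemma pg_pt_subset_iff:
  assumes "vec.subspace l"
  shows "pg_pt x y z \<subseteq> l \<longleftrightarrow> vector [x, y, z] \<in> l"
proof
  show "pg_pt x y z \<subseteq> l \<Longrightarrow> vector [x, y, z] \<in> l"
    unfolding pg_pt_def by (meson insertI1 subsetD vec.span_base)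
  show "vector [x, y, z] \<in> l \<Longrightarrow> pg_pt x y z \<subseteq> l"
    unfolding pg_pt_def using assms by (simp add: vec.span_minimal)
qed

lemma pg_conic_subset: "pg_conic \<subseteq> pg_points"
  by (auto simp: pg_conic_def intro!: pg_pt_in_points)

lemma pg_pt_conic_eq_iff: "pg_pt 1 s (s\<^sup>2) = pg_pt 1 t (t\<^sup>2) \<longleftrightarrow> s = t"
proof
  assume "pg_pt 1 s (s\<^sup>2) = pg_pt 1 t (t\<^sup>2)"
  then have "vector [1, s, s\<^sup>2] \<in> vec.span {vector [1, t, t\<^sup>2] :: 'a ^ 3}"
    unfolding pg_pt_def by (metis vec.span_base insertI1)
  then show "s = t"
    by (auto simp: vec.span_singleton vec_eq_iff forall_3)
qed auto

lemma pg_pt_conic_infinity: "pg_pt 1 t (t\<^sup>2) \<noteq> pg_pt 0 0 1"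
proof
  assume "pg_pt 1 t (t\<^sup>2) = pg_pt 0 0 1"
  then have "vector [1, t, t\<^sup>2] \<in> vec.span {vector [0, 0, 1] :: 'a ^ 3}"
    unfolding pg_pt_def by (metis vec.span_base insertI1)
  then show False
    by (auto simp: vec.span_singleton vec_eq_iff forall_3)
qed

lemma card_pg_conic: "card (pg_conic :: ('a::{field,finite} ^ 3) set set) = CARD('a) + 1"
proof -
  have "inj (\<lambda>t::'a. pg_pt 1 t (t\<^sup>2))" by (simp add: inj_def pg_pt_conic_eq_iff)
  moreover have "pg_pt 0 0 1 \<notin> range (\<lambda>t::'a. pg_pt 1 t (t\<^sup>2))"
    by (auto simp: pg_pt_conic_infinity[symmetric])
  ultimately show ?thesis by (simp add: pg_conic_def card_image)
qed

text \<open>The line through the affine conic points with parameters \<open>s\<close> and \<open>t\<close> is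
  \<open>z - (s + t) y + s t x = 0\<close>, and on the conic this form is \<open>(r - s) (r - t)\<close>.\<close>

lemma pg_line_conic_form:
  fixes l :: "('a::field ^ 3) set"
  assumes l: "l \<in> pg_lines" and "s \<noteq> t" "pg_pt 1 s (s\<^sup>2) \<subseteq> l" "pg_pt 1 t (t\<^sup>2) \<subseteq> l" "x \<in> l"
  shows "x $ 3 - (s + t) * x $ 2 + s * t * x $ 1 = 0"
proof -
  let ?v = "\<lambda>t::'a. vector [1, t, t\<^sup>2] :: 'a ^ 3"
  have "?v s \<in> l" "?v t \<in> l" using assms by (simp_all add: pg_lines_def pg_pt_subset_iff)
  moreover have "?v t \<notin> vec.span {?v s}"
    using \<open>s \<noteq> t\<close> by (auto simp: vec.span_singleton vec_eq_iff forall_3)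
  moreover have "?v s \<noteq> 0" by (auto simp: vec_eq_iff forall_3)
  ultimately have "l = vec.span {?v s, ?v t}" using pg_line_eq_span l by blast
  then obtain a b where "x - a *s ?v s = b *s ?v t"
    using \<open>x \<in> l\<close> by (auto simp: vec.span_breakdown_eq vec.span_singleton)
  then have "x = a *s ?v s + b *s ?v t" by (simp add: diff_eq_eq add.commute)
  then show ?thesis by (simp add: algebra_simps power2_eq_square)
qed

lemma pg_line_conic_pt:
  assumes l: "l \<in> pg_lines" and "s \<noteq> t" "pg_pt 1 s (s\<^sup>2) \<subseteq> l" "pg_pt 1 t (t\<^sup>2) \<subseteq> l"
    and P: "P \<in> pg_conic" "P \<subseteq> l"
  shows "P = pg_pt 1 s (s\<^sup>2) \<or> P = pg_pt 1 t (t\<^sup>2)"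
proof -
  have sub: "vec.subspace l" using l by (simp add: pg_lines_def)
  consider r where "P = pg_pt 1 r (r\<^sup>2)" | "P = pg_pt 0 0 1" using P by (auto simp: pg_conic_def)
  then show ?thesis
  proof cases
    case 1
    then have "vector [1, r, r\<^sup>2] \<in> l" using P sub pg_pt_subset_iff by blast
    then have "r\<^sup>2 - (s + t) * r + s * t = 0" using pg_line_conic_form[OF assms(1-4)] by fastforce
    then have "(r - s) * (r - t) = 0" by (simp add: algebra_simps power2_eq_square)
    then show ?thesis using 1 by auto
  next
    case 2
    then have "vector [0, 0, 1] \<in> l" using P sub pg_pt_subset_iff by blast
    \<comment> \<open>At \<open>(0, 0, 1)\<close> the form takes the value 1, so this point is not
      on the line.\<close>
    then have "(1::'a) = 0" using pg_line_conic_form[OF assms(1-4)] by fastforce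
    then show ?thesis by simp
  qed
qed

text \<open>With two affine conic points on \<open>l\<close>, these are all; otherwise there is at
  most one affine point, plus possibly \<open>pg_pt 0 0 1\<close>.\<close>

lemma pg_conic_arc:
  fixes l :: "('a::{field,finite} ^ 3) set"
  assumes l: "l \<in> pg_lines"
  shows "card {P \<in> pg_conic. P \<subseteq> l} \<le> 2"
proof (cases "\<exists>s t. s \<noteq> t \<and> pg_pt 1 s (s\<^sup>2) \<subseteq> l \<and> pg_pt 1 t (t\<^sup>2) \<subseteq> l")
  case True
  then obtain s t where st: "s \<noteq> t" "pg_pt 1 s (s\<^sup>2) \<subseteq> l" "pg_pt 1 t (t\<^sup>2) \<subseteq> l" by blast
  then have "{P \<in> pg_conic. P \<subseteq> l} \<subseteq> {pg_pt 1 s (s\<^sup>2), pg_pt 1 t (t\<^sup>2)}"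
    using pg_line_conic_pt[OF l] by blast
  then have "card {P \<in> pg_conic. P \<subseteq> l} \<le> card {pg_pt 1 s (s\<^sup>2), pg_pt 1 t (t\<^sup>2)}"
    by (intro card_mono) auto
  also have "\<dots> \<le> 2" by (simp add: card_insert_if)
  finally show ?thesis .
next
  case False
  then have "\<exists>s. \<forall>t. pg_pt 1 t (t\<^sup>2) \<subseteq> l \<longrightarrow> t = s" by metis
  then obtain s where "\<forall>t. pg_pt 1 t (t\<^sup>2) \<subseteq> l \<longrightarrow> t = s" by blast
  then have "{P \<in> pg_conic. P \<subseteq> l} \<subseteq> {pg_pt 1 s (s\<^sup>2), pg_pt 0 0 1}"
    by (auto simp: pg_conic_def)
  then have "card {P \<in> pg_conic. P \<subseteq> l} \<le> card {pg_pt 1 s (s\<^sup>2), pg_pt 0 0 1}"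
    by (intro card_mono) auto
  also have "\<dots> \<le> 2" by (simp add: card_insert_if)
  finally show ?thesis .
qed

lemma oval_pg_conic:
  assumes "CARD('a::{field,finite}) \<ge> 2"
  shows "oval (pg_points :: ('a ^ 3) set set) pg_lines (\<subseteq>) CARD('a) pg_conic"
proof unfold_locales
  fix l m :: "('a ^ 3) set"
  assume "l \<in> pg_lines" "m \<in> pg_lines" "l \<noteq> m"
  then show "\<exists>a\<in>pg_points. a \<subseteq> l \<and> a \<subseteq> m" using pg_meet_exists by blast
qed (use assms pg_join_exists pg_incidence_unique card_pg_line pg_conic_subset card_pg_conic
  pg_conic_arc in \<open>simp_all\<close>)

theorem proposition6p9:
  fixes q :: nat and P1 P2 :: "('a::{field,finite} ^ 3) set"
    and K :: "('a ^ 3) set set"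
  assumes q: "CARD('a) = q" "q \<ge> 7"
    and P: "P1 \<in> pg_conic" "P2 \<in> pg_conic" "P1 \<noteq> P2"
    and K: "K = pg_conic - {P1, P2}"
  shows "(odd q \<longrightarrow>
            {i. c_num K i \<noteq> 0} = {(q - 1) div 2, (q - 3) div 2, (q - 5) div 2, 0} \<and>
            c_num K ((q - 1) div 2) = (q + 1) div 2 \<and>
            c_num K ((q - 3) div 2) = ((q - 1) * (q + 4)) div 2 \<and>
            c_num K ((q - 5) div 2) = ((q - 1) * (q - 3)) div 2 \<and>
            c_num K 0 = 2) \<and>
         (even q \<longrightarrow>
            {i. c_num K i \<noteq> 0} = {(q - 2) div 2, (q - 4) div 2, 0} \<and>
            c_num K ((q - 2) div 2) = 3 * (q - 1) \<and>
            c_num K ((q - 4) div 2) = (q - 1) * (q - 2) \<and>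
            c_num K 0 = 3)"
proof -
  interpret oval "pg_points :: ('a ^ 3) set set" pg_lines "(\<subseteq>)" q pg_conic
    using oval_pg_conic[where 'a = 'a] q by simp
  obtain t1 t2 where t: "t1 \<in> tangents" "P1 \<subseteq> t1" "t2 \<in> tangents" "P2 \<subseteq> t2"
    using tangent_exists[OF P(1)] tangent_exists[OF P(2)] by metis
  obtain m where m: "m \<in> pg_lines" "P1 \<subseteq> m" "P2 \<subseteq> m"
    using pg_join_exists P pg_conic_subset by blast
  interpret minus: oval_minus_two "pg_points :: ('a ^ 3) set set" pg_lines "(\<subseteq>)" q pg_conic
      P1 P2 t1 t2 m
    using P t m by unfold_locales
  \<comment> \<open>With inclusion as incidence, both sides agree by unfolding definitions.\<close>
  have "c_num K = minus.point_count"
    by (simp add: fun_eq_iff c_num_def minus.point_count_def sec_num_def secants_def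
      bisecants_def K)
  then show ?thesis
    using minus.point_count_odd minus.point_count_even q(2) by simp
qed

end
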